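(* Let $A$ be a finite alphabet with $\#(A)\ge 2$. For any star-free language $L\subseteq A^*$ and any group language $K\subseteq A^*$, we have $$\delta_A(L\cap K)=\delta_A(L)\cdot\delta_A(K).$$
   Context: $\#(X)$ denotes the cardinality of a set $X$. For $L\subseteq A^*$, the density is $\delta_A(L)=\lim_{n\to\infty}\frac1n\sum_{k=0}^{n-1}\frac{\#(L\cap A^k)}{\#(A^k)}$ if the limit exists; every regular language has a density. A monoid $M$ recognises $L\subseteq A^*$ if there are a monoid morphism $\eta:A^*\to M$ and $S\subseteq M$ with $L=\eta^{-1}(S)$. Green's relation $\mathcal H$ on $M$: $x\mathrel{\mathcal H}y$ iff $xM=yM$ and $Mx=My$; $M$ is $\mathcal H$-trivial if every $\mathcal H$-class is a singleton. A star-free language is a language recognised by a finite $\mathcal H$-trivial (equivalently, finite aperiodic) monoid. A group language is a language recognised by a finite group. *)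

theory Defs
  imports Complex_Main "HOL-Library.NList" "HOL-Algebra.Weak_Morphisms"
begin

definition lang_density_avg :: "'a set \<Rightarrow> 'a list set \<Rightarrow> nat \<Rightarrow> real" where
  "lang_density_avg A L n =
     1 / real n * (\<Sum>k<n. real (card (L \<inter> nlists k A)) / real (card (nlists k A)))"

definition has_density :: "'a set \<Rightarrow> 'a list set \<Rightarrow> bool" where
  "has_density A L \<longleftrightarrow> convergent (lang_density_avg A L)"

text \<open>The value is unspecified unless \<^const>\<open>has_density\<close> holds.\<close>

definition lang_density :: "'a set \<Rightarrow> 'a list set \<Rightarrow> real" where
  "lang_density A L = lim (lang_density_avg A L)"

definition free_monoid :: "'a set \<Rightarrow> 'a list monoid" where
  "free_monoid A = \<lparr>carrier = lists A, mult = (@), one = []\<rparr>"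

text \<open>Elements of \<^const>\<open>hom\<close> need not preserve the unit, hence the explicit condition for a
  morphism of monoids.\<close>

definition recognises ::
  "('m, 'b) monoid_scheme \<Rightarrow> 'a set \<Rightarrow> 'a list set \<Rightarrow> bool" where
  "recognises M A L \<longleftrightarrow>
     (\<exists>\<eta> S. \<eta> \<in> hom (free_monoid A) M \<and> \<eta> \<one>\<^bsub>free_monoid A\<^esub> = \<one>\<^bsub>M\<^esub> \<and>
        S \<subseteq> carrier M \<and> L = {w \<in> lists A. \<eta> w \<in> S})"

definition green_H :: "('m, 'b) monoid_scheme \<Rightarrow> ('m \<times> 'm) set" where
  "green_H M = {(x, y). x \<in> carrier M \<and> y \<in> carrier M \<and>
     x <#\<^bsub>M\<^esub> carrier M = y <#\<^bsub>M\<^esub> carrier M \<and>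
     carrier M #>\<^bsub>M\<^esub> x = carrier M #>\<^bsub>M\<^esub> y}"

definition H_trivial :: "('m, 'b) monoid_scheme \<Rightarrow> bool" where
  "H_trivial M \<longleftrightarrow> (\<forall>C \<in> carrier M // green_H M. is_singleton C)"

text \<open>HOL cannot quantify existentially over the type of the monoid. Restricting to carriers in
  \<^typ>\<open>nat\<close> loses nothing, as every finite monoid is isomorphic to such a one; see
  \<open>star_free_languageI\<close> and \<open>group_languageI\<close> below.\<close>

definition star_free_language :: "'a set \<Rightarrow> 'a list set \<Rightarrow> bool" where
  "star_free_language A L \<longleftrightarrow>
     (\<exists>M :: nat monoid. monoid M \<and> finite (carrier M) \<and> H_trivial M \<and> recognises M A L)"

definition group_language :: "'a set \<Rightarrow> 'a list set \<Rightarrow> bool" where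
  "group_language A K \<longleftrightarrow>
     (\<exists>G :: nat monoid. group G \<and> finite (carrier G) \<and> recognises G A K)"

lemma image_group_mult:
  assumes "inj_on f (carrier M)" "x \<in> carrier M" "y \<in> carrier M"
  shows "f x \<otimes>\<^bsub>image_group f M\<^esub> f y = f (x \<otimes>\<^bsub>M\<^esub> y)"
  using assms by (simp add: image_group_def)

lemma monoid_image_group:
  assumes "monoid M" "inj_on f (carrier M)"
  shows "monoid (image_group f M)"
proof -
  interpret monoid M by fact
  show ?thesis
    by (rule monoidI)
      (auto simp: image_group_carrier image_group_one image_group_mult[OF assms(2)] m_assoc)
qed

lemma group_image_group:
  assumes "group G" "inj_on f (carrier G)"
  shows "group (image_group f G)"
proof -
  interpret group G by fact
  interpret N: monoid "image_group f G"
    using monoid_image_group[OF _ assms(2)] monoid_axioms .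
  show ?thesis
  proof (rule N.group_l_invI)
    fix y assume "y \<in> carrier (image_group f G)"
    then obtain x where x: "x \<in> carrier G" "y = f x"
      by (auto simp: image_group_carrier)
    then have "f (inv\<^bsub>G\<^esub> x) \<otimes>\<^bsub>image_group f G\<^esub> y = \<one>\<^bsub>image_group f G\<^esub>"
      by (simp add: image_group_mult[OF assms(2)] image_group_one)
    with x show "\<exists>z\<in>carrier (image_group f G).
        z \<otimes>\<^bsub>image_group f G\<^esub> y = \<one>\<^bsub>image_group f G\<^esub>"
      by (auto simp: image_group_carrier)
  qed
qed

lemma recognises_image_group:
  assumes "monoid M" "inj_on f (carrier M)" "recognises M A L"
  shows "recognises (image_group f M) A L"
proof -
  interpret monoid M by fact
  from assms(3) obtain \<eta> S where
    \<eta>: "\<eta> \<in> hom (free_monoid A) M" "\<eta> \<one>\<^bsub>free_monoid A\<^esub> = \<one>\<^bsub>M\<^esub>"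
       "S \<subseteq> carrier M" "L = {w \<in> lists A. \<eta> w \<in> S}"
    unfolding recognises_def by blast
  have car: "\<eta> w \<in> carrier M" if "w \<in> lists A" for w
    using that \<eta>(1) by (auto simp: hom_def free_monoid_def)
  have "f \<circ> \<eta> \<in> hom (free_monoid A) (image_group f M)"
    using \<eta>(1) car
    by (auto simp: hom_def free_monoid_def image_group_carrier image_group_mult[OF assms(2)] Pi_def)
  moreover have "(f \<circ> \<eta>) \<one>\<^bsub>free_monoid A\<^esub> = \<one>\<^bsub>image_group f M\<^esub>"
    using \<eta>(2) by (simp add: image_group_one)
  moreover have "f ` S \<subseteq> carrier (image_group f M)"
    using \<eta>(3) by (auto simp: image_group_carrier)
  moreover have "L = {w \<in> lists A. (f \<circ> \<eta>) w \<in> f ` S}"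
    using inj_on_image_mem_iff[OF assms(2) car \<eta>(3)] unfolding \<eta>(4) by auto
  ultimately show ?thesis
    unfolding recognises_def by blast
qed

lemma equiv_green_H: "equiv (carrier M) (green_H M)"
  by (auto simp: green_H_def equiv_def refl_on_def sym_def trans_def)

lemma H_trivial_iff: "H_trivial M \<longleftrightarrow> (\<forall>x y. (x, y) \<in> green_H M \<longrightarrow> x = y)"
proof
  assume H: "H_trivial M"
  show "\<forall>x y. (x, y) \<in> green_H M \<longrightarrow> x = y"
  proof (intro allI impI)
    fix x y assume xy: "(x, y) \<in> green_H M"
    then have x: "x \<in> carrier M" "(x, x) \<in> green_H M"
      by (auto simp: green_H_def)
    then have "is_singleton (green_H M `` {x})"
      using H by (auto simp: H_trivial_def intro: quotientI)
    with xy x show "x = y"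
      by (metis Image_singleton_iff is_singleton_def singletonD)
  qed
next
  assume H: "\<forall>x y. (x, y) \<in> green_H M \<longrightarrow> x = y"
  show "H_trivial M"
    unfolding H_trivial_def
  proof
    fix C assume "C \<in> carrier M // green_H M"
    then obtain x where x: "x \<in> carrier M" "C = green_H M `` {x}"
      by (rule quotientE)
    then have "(x, x) \<in> green_H M"
      by (simp add: green_H_def)
    with x H have "C = {x}" by auto
    then show "is_singleton C" by simp
  qed
qed

lemma H_trivial_image_group:
  assumes "monoid M" "inj_on f (carrier M)" "H_trivial M"
  shows "H_trivial (image_group f M)"
  unfolding H_trivial_iff
proof (intro allI impI)
  interpret monoid M by fact
  fix a b assume ab: "(a, b) \<in> green_H (image_group f M)"
  then obtain x y where xy: "x \<in> carrier M" "y \<in> carrier M" "a = f x" "b = f y"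
    by (auto simp: green_H_def image_group_carrier)
  have l: "f z <#\<^bsub>image_group f M\<^esub> carrier (image_group f M) = f ` (z <#\<^bsub>M\<^esub> carrier M)"
    and r: "carrier (image_group f M) #>\<^bsub>image_group f M\<^esub> f z = f ` (carrier M #>\<^bsub>M\<^esub> z)"
    if "z \<in> carrier M" for z
    using that
    by (auto simp: l_coset_def r_coset_def image_group_carrier image_group_mult[OF assms(2)])
  have sub: "z <#\<^bsub>M\<^esub> carrier M \<subseteq> carrier M" "carrier M #>\<^bsub>M\<^esub> z \<subseteq> carrier M"
    if "z \<in> carrier M" for z
    using that by (auto simp: l_coset_def r_coset_def)
  have "f ` (x <#\<^bsub>M\<^esub> carrier M) = f ` (y <#\<^bsub>M\<^esub> carrier M)"
    "f ` (carrier M #>\<^bsub>M\<^esub> x) = f ` (carrier M #>\<^bsub>M\<^esub> y)"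
    using ab xy l r by (auto simp: green_H_def)
  then have "(x, y) \<in> green_H M"
    using xy sub inj_on_image_eq_iff[OF assms(2)] by (simp add: green_H_def)
  then have "x = y"
    using assms(3) by (simp add: H_trivial_iff)
  with xy show "a = b" by simp
qed

lemma star_free_languageI:
  assumes "monoid M" "finite (carrier M)" "H_trivial M" "recognises M A L"
  shows "star_free_language A L"
proof -
  obtain f :: "_ \<Rightarrow> nat" where "inj_on f (carrier M)"
    using finite_imp_inj_to_nat_seg[OF assms(2)] by blast
  with assms show ?thesis
    unfolding star_free_language_def
    by (intro exI[of _ "image_group f M"])
      (simp add: monoid_image_group H_trivial_image_group recognises_image_group image_group_carrier)
qed

lemma group_languageI:
  assumes "group G" "finite (carrier G)" "recognises G A K"
  shows "group_language A K"
proof -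
  obtain f :: "_ \<Rightarrow> nat" where "inj_on f (carrier G)"
    using finite_imp_inj_to_nat_seg[OF assms(2)] by blast
  with assms show ?thesis
    unfolding group_language_def
    by (intro exI[of _ "image_group f G"])
      (simp add: group_image_group group.is_monoid recognises_image_group image_group_carrier)
qed

end

theory Submission
  imports Defs "HOL-Library.Sublist"
begin

text \<open>Let \<open>m\<close> and \<open>g\<close> be morphisms recognising \<open>L\<close> and \<open>K\<close>. A random word is likely to have a prefix
  \<open>u\<close> and a suffix \<open>v\<close>, both of a fixed length \<open>s\<close>, whose images under \<open>m\<close> lie in the minimal ideal
  of the image of \<open>m\<close>. By \<open>\<H>\<close>-triviality \<open>m (u z v) = m (u v)\<close> for every \<open>z\<close>, so that \<open>u\<close> and \<open>v\<close>
  alone decide membership in \<open>L\<close>. Conditionally on \<open>u\<close> and \<open>v\<close>, the element \<open>g z\<close> is still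
  equidistributed on average over the image of \<open>g\<close>, and hence so is \<open>g (u z v)\<close>.\<close>

text \<open>The length in the premise of this rule is not determined by its conclusion, and the simplifier
  loops on it.\<close>

declare nlistsE_set [simp del]

subsection \<open>Averages over words of fixed length\<close>

definition word_avg :: "'a set \<Rightarrow> nat \<Rightarrow> ('a list \<Rightarrow> real) \<Rightarrow> real" where
  "word_avg A k f = (\<Sum>w\<in>nlists k A. f w) / real (card (nlists k A))"

definition cesaro :: "(nat \<Rightarrow> real) \<Rightarrow> nat \<Rightarrow> real" where
  "cesaro f n = 1 / real n * (\<Sum>k<n. f k)"

locale finite_alphabet =
  fixes A :: "'a set"
  assumes finite_A: "finite A" and nonempty_A: "A \<noteq> {}"
begin

lemma nlists_eq: "nlists k A = {w. set w \<subseteq> A \<and> length w = k}"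
  unfolding nlists_def by (rule Collect_cong) (rule conj_commute)

lemma finite_nlists: "finite (nlists k A)"
  unfolding nlists_eq by (rule finite_lists_length_eq[OF finite_A])

lemma card_nlists: "card (nlists k A) = card A ^ k"
  unfolding nlists_eq by (rule card_lists_length_eq[OF finite_A])

lemma card_nlists_pos: "0 < card (nlists k A)"
  unfolding card_nlists using finite_A nonempty_A by (intro zero_less_power) (simp add: card_gt_0_iff)

lemma nlists_in_lists: "w \<in> nlists k A \<Longrightarrow> w \<in> lists A"
  by (auto dest!: nlistsE_set)

lemma word_avg_cong:
  "(\<And>w. w \<in> nlists k A \<Longrightarrow> f w = g w) \<Longrightarrow> word_avg A k f = word_avg A k g"
  by (simp add: word_avg_def)

lemma word_avg_mono:
  "(\<And>w. w \<in> nlists k A \<Longrightarrow> f w \<le> g w) \<Longrightarrow> word_avg A k f \<le> word_avg A k g"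
  by (simp add: word_avg_def divide_right_mono sum_mono)

lemma word_avg_const [simp]: "word_avg A k (\<lambda>_. c) = c"
  using card_nlists_pos[of k] by (simp add: word_avg_def)

lemma word_avg_diff: "word_avg A k (\<lambda>w. f w - g w) = word_avg A k f - word_avg A k g"
  by (simp add: word_avg_def sum_subtractf diff_divide_distrib)

lemma word_avg_add: "word_avg A k (\<lambda>w. f w + g w) = word_avg A k f + word_avg A k g"
  by (simp add: word_avg_def sum.distrib add_divide_distrib)

lemma word_avg_cmult: "word_avg A k (\<lambda>w. c * f w) = c * word_avg A k f"
  by (simp add: word_avg_def sum_distrib_left)

lemma word_avg_multc: "word_avg A k (\<lambda>w. f w * c) = word_avg A k f * c"
  by (simp add: word_avg_def sum_distrib_right)

lemma word_avg_sum: "word_avg A k (\<lambda>w. \<Sum>i\<in>I. f i w) = (\<Sum>i\<in>I. word_avg A k (f i))"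
  unfolding word_avg_def by (subst sum.swap) (simp add: sum_divide_distrib)

lemma word_avg_swap:
  "word_avg A j (\<lambda>u. word_avg A k (f u)) = word_avg A k (\<lambda>v. word_avg A j (\<lambda>u. f u v))"
  unfolding word_avg_def sum_divide_distrib by (subst sum.swap) (simp add: mult.commute)

lemma word_avg_abs_le: "\<bar>word_avg A k f\<bar> \<le> word_avg A k (\<lambda>w. \<bar>f w\<bar>)"
  by (simp add: word_avg_def divide_right_mono)

lemma word_avg_nonneg: "(\<And>w. w \<in> nlists k A \<Longrightarrow> 0 \<le> f w) \<Longrightarrow> 0 \<le> word_avg A k f"
  using word_avg_mono[of k "\<lambda>_. 0" f] by simp

lemma word_avg_le_1: "(\<And>w. w \<in> nlists k A \<Longrightarrow> f w \<le> 1) \<Longrightarrow> word_avg A k f \<le> 1"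
  using word_avg_mono[of k f "\<lambda>_. 1"] by simp

lemma word_avg_append:
  "word_avg A (j + k) f = word_avg A j (\<lambda>u. word_avg A k (\<lambda>v. f (u @ v)))"
proof -
  have "(\<Sum>w\<in>nlists (j + k) A. f w) = (\<Sum>(u, v)\<in>nlists j A \<times> nlists k A. f (u @ v))"
    by (rule sum.reindex_bij_witness[where i = "\<lambda>(u, v). u @ v" and j = "\<lambda>w. (take j w, drop j w)"])
      (auto intro!: nlistsI nlists_appendI dest: in_set_takeD in_set_dropD nlistsE_set)
  also have "\<dots> = (\<Sum>u\<in>nlists j A. \<Sum>v\<in>nlists k A. f (u @ v))"
    by (simp add: sum.cartesian_product)
  finally show ?thesis
    by (simp add: word_avg_def card_nlists power_add divide_divide_eq_left mult.commute flip: sum_divide_distrib)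
qed

lemma tendsto_word_avg:
  assumes "\<And>w. w \<in> nlists k A \<Longrightarrow> ((\<lambda>n. f n w) \<longlongrightarrow> g w) F"
  shows "((\<lambda>n. word_avg A k (f n)) \<longlongrightarrow> word_avg A k g) F"
  unfolding word_avg_def using assms card_nlists_pos[of k]
  by (intro tendsto_divide tendsto_sum tendsto_const) auto

lemma cesaro_word_avg: "cesaro (\<lambda>j. word_avg A k (f j)) n = word_avg A k (\<lambda>w. cesaro (\<lambda>j. f j w) n)"
  unfolding cesaro_def word_avg_cmult word_avg_sum ..

lemma lang_density_avg_eq_cesaro:
  "lang_density_avg A L = cesaro (\<lambda>k. word_avg A k (\<lambda>w. of_bool (w \<in> L)))"
proof -
  have "(\<Sum>w\<in>nlists k A. of_bool (w \<in> L)) = real (card (L \<inter> nlists k A))" for k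
    using finite_nlists[of k] by (simp add: of_bool_def sum.If_cases Int_commute)
  then show ?thesis
    by (intro ext) (simp add: lang_density_avg_def cesaro_def word_avg_def)
qed

end

section \<open>Cesaro means of real sequences\<close>

lemma cesaro_cmult: "cesaro (\<lambda>k. c * f k) n = c * cesaro f n"
  unfolding cesaro_def sum_distrib_left[symmetric] by (rule mult.left_commute)

lemma cesaro_sum: "cesaro (\<lambda>k. \<Sum>i\<in>I. f i k) n = (\<Sum>i\<in>I. cesaro (f i) n)"
  unfolding cesaro_def by (subst sum.swap) (rule sum_distrib_left)

lemma cesaro_diff_le:
  assumes "\<And>k. \<bar>f k - g k\<bar> \<le> c"
  shows "\<bar>cesaro f n - cesaro g n\<bar> \<le> c"
proof (cases "n = 0")
  case True
  then show ?thesis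
    using assms[of 0] by (simp add: cesaro_def)
next
  case False
  have "cesaro f n - cesaro g n = (\<Sum>k<n. f k - g k) / real n"
    by (simp add: cesaro_def sum_subtractf diff_divide_distrib)
  then have "\<bar>cesaro f n - cesaro g n\<bar> = \<bar>\<Sum>k<n. f k - g k\<bar> / real n"
    by simp
  also have "\<dots> \<le> (\<Sum>k<n. \<bar>f k - g k\<bar>) / real n"
    by (intro divide_right_mono sum_abs) simp
  also have "\<dots> \<le> (\<Sum>k<n. c) / real n"
    by (intro divide_right_mono sum_mono assms) simp
  finally show ?thesis
    using False by simp
qed

text \<open>Each shift by one position adds one value in [0,1] to the sum and removes another, so it
  moves the sum by at most 1. For \<open>n = 0\<close> both sides are 0.\<close>

lemma cesaro_offset_diff_le:
  assumes "\<And>k. 0 \<le> f k" "\<And>k. f k \<le> 1"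
  shows "\<bar>cesaro (\<lambda>k. f (k + l)) n - cesaro f n\<bar> \<le> real l / real n"
proof -
  have "\<bar>(\<Sum>k<n. f (k + l)) - (\<Sum>k<n. f k)\<bar> \<le> real l" for n
  proof (induction l)
    case (Suc l)
    have "(\<Sum>k<n. f (k + Suc l)) - (\<Sum>k<n. f (k + l)) = f (n + l) - f l"
      using sum_lessThan_telescope[of "\<lambda>k. f (k + l)" n] by (simp add: sum_subtractf)
    then show ?case
      using Suc assms(1)[of "n + l"] assms(2)[of "n + l"] assms(1)[of l] assms(2)[of l] by simp
  qed simp
  then show ?thesis
    unfolding cesaro_def right_diff_distrib[symmetric] abs_mult
    by (simp add: divide_right_mono)
qed

text \<open>Finitely many initial terms do not influence a Cesaro limit, even without a bound on
  \<open>f\<close>. The induction restores the dropped terms one at a time.\<close>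

lemma cesaro_tendsto_offset:
  assumes "cesaro (\<lambda>k. f (k + l)) \<longlonglongrightarrow> c"
  shows "cesaro f \<longlonglongrightarrow> c"
  using assms
proof (induction l)
  case (Suc l)
  let ?f = "\<lambda>k. f (k + l)"
  \<comment> \<open>The first term is split off. Its share tends to 0, and the factor
    \<open>real n / real (Suc n)\<close> corrects the normalisation of the remaining mean.\<close>
  have "cesaro ?f (Suc n) = ?f 0 / real (Suc n) + cesaro (\<lambda>k. f (k + Suc l)) n * (real n / real (Suc n))" for n
  proof -
    have "(\<Sum>k<Suc n. ?f k) = ?f 0 + (\<Sum>k<n. f (k + Suc l))"
      by (subst sum.lessThan_Suc_shift) simp
    then show ?thesis
      unfolding cesaro_def by (cases "n = 0") (simp_all del: sum.lessThan_Suc add: add_divide_distrib)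
  qed
  moreover have "(\<lambda>n. ?f 0 / real (Suc n) + cesaro (\<lambda>k. f (k + Suc l)) n * (real n / real (Suc n)))
      \<longlonglongrightarrow> 0 + c * 1"
    by (intro tendsto_add tendsto_mult Suc.prems LIMSEQ_n_over_Suc_n
        filterlim_compose[OF lim_const_over_n filterlim_Suc])
  ultimately have "cesaro ?f \<longlonglongrightarrow> c"
    by (subst filterlim_sequentially_Suc[symmetric]) simp
  then show ?case
    by (rule Suc.IH)
qed simp

locale word_morphism = finite_alphabet A + monoid M
  for A :: "'a set" and M (structure) +
  fixes g
  assumes finite_carrier: "finite (carrier M)"
    and g_closed [simp]: "w \<in> lists A \<Longrightarrow> g w \<in> carrier M"
    and g_append: "u \<in> lists A \<Longrightarrow> v \<in> lists A \<Longrightarrow> g (u @ v) = g u \<otimes> g v"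
    and g_Nil: "g [] = \<one>"

subsection \<open>Equidistribution in finite groups\<close>

locale group_word_morphism = word_morphism + group M
begin

text \<open>\<open>g\<close> need not be onto, so equidistribution can only be expected on its
  image, which turns out to be a subgroup.\<close>

abbreviation reachable where "reachable \<equiv> g ` lists A"

text \<open>Time-averaged occupation frequencies of the random walk that starts at the identity and
  multiplies on the right by the image of a uniform letter.\<close>

abbreviation visits where
  "visits h \<equiv> cesaro (\<lambda>k. word_avg A k (\<lambda>w. of_bool (g w = h)))"

lemma finite_reachable: "finite reachable"
  using g_closed by (intro finite_subset[OF _ finite_carrier]) blast

lemma reachable_mult: "x \<in> reachable \<Longrightarrow> y \<in> reachable \<Longrightarrow> x \<otimes> y \<in> reachable"
  by (elim imageE, simp only: g_append[symmetric]) (simp only: imageI append_in_lists_conv)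

lemma reachable_closed: "x \<in> reachable \<Longrightarrow> x \<in> carrier M"
  using g_closed by blast

lemma reachable_one: "\<one> \<in> reachable"
  by (rule image_eqI[where x = "[]"]) (simp_all add: g_Nil)

lemma card_reachable_pos: "0 < card reachable"
  using finite_reachable reachable_one by (auto simp: card_gt_0_iff)

text \<open>Left multiplication by \<open>x\<close> is an injective self-map of a finite set, hence
  onto, so some reachable \<open>y\<close> satisfies \<open>x \<otimes> y = \<one>\<close>.\<close>

lemma reachable_inv:
  assumes "x \<in> reachable"
  shows "inv x \<in> reachable"
proof -
  have "(\<otimes>) x ` reachable = reachable"
    using assms reachable_mult reachable_closed
    by (intro endo_inj_surj finite_reachable) (auto simp: inj_on_def)
  then obtain y where "y \<in> reachable" "x \<otimes> y = \<one>"
    using reachable_one by (metis imageE)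
  then show ?thesis
    using inv_equality[of y x] inv_comm[of x y] assms reachable_closed by simp
qed

text \<open>Split off the first \<open>l\<close> letters \<open>v\<close>: the rest must be sent to
  \<open>inv (g v) \<otimes> h\<close>. The average over \<open>v\<close> is thus the Cesaro mean
  shifted by \<open>l\<close>, and the shift costs at most \<open>l / n\<close>.\<close>

lemma visits_step:
  assumes "h \<in> carrier M"
  shows "\<bar>word_avg A l (\<lambda>v. visits (inv (g v) \<otimes> h) n) - visits h n\<bar> \<le> real l / real n"
proof -
  let ?f = "\<lambda>k. word_avg A k (\<lambda>w. of_bool (g w = h))"
  have "?f (k + l) = word_avg A l (\<lambda>v. word_avg A k (\<lambda>w. of_bool (g w = inv (g v) \<otimes> h)))" for k
  proof -
    have "g (v @ w) = h \<longleftrightarrow> g w = inv (g v) \<otimes> h"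
      if "v \<in> nlists l A" "w \<in> nlists k A" for v w
    proof -
      have "v \<in> lists A" "w \<in> lists A"
        using that nlists_in_lists by blast+
      then show ?thesis
        using inv_solve_left[of "g w" "g v" h] assms by (simp add: g_append eq_commute[of h])
    qed
    then show ?thesis
      unfolding add.commute[of k l] word_avg_append by (intro word_avg_cong) simp
  qed
  then have "word_avg A l (\<lambda>v. visits (inv (g v) \<otimes> h) n) = cesaro (\<lambda>k. ?f (k + l)) n"
    by (simp add: cesaro_word_avg)
  then show ?thesis
    using cesaro_offset_diff_le[of ?f l n] by (simp add: word_avg_nonneg word_avg_le_1)
qed

text \<open>A quantitative maximum principle: the occupation frequencies are harmonic up to an error
  \<open>l / n\<close>, so the value at any point that a word of length \<open>l\<close> connects to the maximum is
  nearly maximal.\<close>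

lemma visits_diff_le:
  "\<exists>C. \<forall>n. \<forall>h\<in>reachable. \<forall>h'\<in>reachable. visits h n - visits h' n \<le> C / real n"
proof -
  have "\<forall>x\<in>reachable. \<exists>w. w \<in> lists A \<and> g w = x"
    by blast
  then obtain W where W: "W x \<in> lists A" "g (W x) = x" if "x \<in> reachable" for x
    unfolding bchoice_iff by blast
  \<comment> \<open>A word \<open>W x\<close> has weight 1 over the number of words of its length in
    an average. Undoing this weight in the error \<open>l / n\<close> gives the factor
    \<open>c x\<close>.\<close>
  define c where "c x = real (card (nlists (length (W x)) A)) * real (length (W x))" for x
  show ?thesis
  proof (intro exI allI ballI)
    fix n h h' assume h: "h \<in> reachable" "h' \<in> reachable"
    obtain m where m: "m \<in> reachable" "\<And>x. x \<in> reachable \<Longrightarrow> visits x n \<le> visits m n"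
    proof -
      have fin: "finite ((\<lambda>x. visits x n) ` reachable)"
        using finite_reachable by (rule finite_imageI)
      have "Max ((\<lambda>x. visits x n) ` reachable) \<in> (\<lambda>x. visits x n) ` reachable"
        using reachable_one by (intro Max_in fin) blast
      then obtain m where "m \<in> reachable" "Max ((\<lambda>x. visits x n) ` reachable) = visits m n"
        by blast
      then show thesis
        using that[of m] Max_ge[OF fin] by (metis imageI)
    qed
    \<comment> \<open>The word \<open>W x\<close> connects the maximum point to \<open>h'\<close>,
      because \<open>inv x \<otimes> m = h'\<close>.\<close>
    define x where "x = m \<otimes> inv h'"
    have x: "x \<in> reachable"
      unfolding x_def using m h by (intro reachable_mult reachable_inv)
    define l where "l = length (W x)"
    let ?d = "\<lambda>v. visits m n - visits (inv (g v) \<otimes> m) n"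
    have d_nonneg: "0 \<le> ?d v" if "v \<in> nlists l A" for v
      using m nlists_in_lists[OF that] reachable_mult reachable_inv by auto
    have Wx: "W x \<in> nlists l A"
      using W(1)[OF x] by (auto simp: l_def intro!: nlistsI)
    have carr: "m \<in> carrier M" "h' \<in> carrier M"
      using m h reachable_closed by auto
    have "inv (g (W x)) \<otimes> m = h'"
      using W(2)[OF x] carr by (simp add: x_def inv_mult_group m_assoc)
    \<comment> \<open>By maximality of \<open>m\<close> no term is negative, so the term of
      \<open>W x\<close> is at most the whole sum, which \<open>visits_step\<close>
      controls.\<close>
    then have "visits m n - visits h' n \<le> (\<Sum>v\<in>nlists l A. ?d v)"
      using member_le_sum[OF Wx, where f = ?d] d_nonneg finite_nlists by simp
    also have "\<dots> = card (nlists l A) * word_avg A l ?d"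
      using card_nlists_pos[of l] by (simp add: word_avg_def)
    also have "\<dots> \<le> card (nlists l A) * (real l / real n)"
      using visits_step[OF carr(1), of l n] by (intro mult_left_mono) (simp_all add: word_avg_diff)
    also have "\<dots> = c x / real n"
      by (simp add: c_def l_def)
    \<comment> \<open>\<open>x\<close> varies with \<open>n\<close> and \<open>h'\<close>; summing
      over all reachable elements makes the constant uniform.\<close>
    also have "\<dots> \<le> (\<Sum>x\<in>reachable. c x) / real n"
      using x finite_reachable by (intro divide_right_mono member_le_sum) (auto simp: c_def)
    finally show "visits h n - visits h' n \<le> (\<Sum>x\<in>reachable. c x) / real n"
      using m(2)[OF h(1)] by simp
  qed
qed

lemma sum_visits:
  assumes "n > 0"
  shows "(\<Sum>h\<in>reachable. visits h n) = 1"
proof -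
  have "(\<Sum>h\<in>reachable. word_avg A k (\<lambda>w. of_bool (g w = h))) = 1" for k
  proof -
    have "(\<Sum>h\<in>reachable. word_avg A k (\<lambda>w. of_bool (g w = h)))
        = word_avg A k (\<lambda>w. \<Sum>h\<in>reachable. of_bool (g w = h))"
      by (simp add: word_avg_sum)
    also have "\<dots> = word_avg A k (\<lambda>w. 1)"
      by (intro word_avg_cong)
        (simp add: of_bool_def finite_reachable nlists_in_lists)
    finally show ?thesis
      by simp
  qed
  then show ?thesis
    using assms unfolding cesaro_sum[symmetric] by (simp add: cesaro_def)
qed

text \<open>The frequencies sum to 1 and differ pairwise by at most \<open>C / n\<close>, so each is
  within \<open>C / n\<close> of their mean.\<close>

lemma visits_tendsto:
  assumes h: "h \<in> reachable"
  shows "visits h \<longlonglongrightarrow> 1 / card reachable"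
proof -
  obtain C where C: "visits x n - visits y n \<le> C / real n"
    if "x \<in> reachable" "y \<in> reachable" for x y n
    using visits_diff_le by blast
  have "norm (visits h n - 1 / card reachable) \<le> norm (C / real n) * 1" if n: "n \<ge> 1" for n
  proof -
    have "card reachable * visits h n - 1 = (\<Sum>x\<in>reachable. visits h n - visits x n)"
      using sum_visits[of n] n by (simp add: sum_subtractf)
    also have "\<bar>\<dots>\<bar> \<le> (\<Sum>x\<in>reachable. \<bar>visits h n - visits x n\<bar>)"
      by (rule sum_abs)
    also have "\<dots> \<le> (\<Sum>x\<in>reachable. C / real n)"
      using C[OF h, of _ n] C[OF _ h, of _ n] by (intro sum_mono) (simp add: abs_le_iff)
    finally have "\<bar>card reachable * visits h n - 1\<bar> \<le> card reachable * (C / real n)"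
      by simp
    moreover have "visits h n - 1 / card reachable = (card reachable * visits h n - 1) / card reachable"
      using card_reachable_pos by (simp add: diff_divide_distrib)
    ultimately have "\<bar>visits h n - 1 / card reachable\<bar> \<le> C / real n"
      using card_reachable_pos by (simp add: abs_divide pos_divide_le_eq mult.commute)
    then show ?thesis
      using abs_ge_self[of "C / real n"] by simp
  qed
  then have "(\<lambda>n. visits h n - 1 / card reachable) \<longlonglongrightarrow> 0"
    by (intro tendsto_0_le[OF lim_const_over_n[of C]] eventually_sequentiallyI[of 1])
  then show ?thesis
    by (rule LIM_zero_cancel)
qed

end

section \<open>Densities of quotients by a prefix and a suffix\<close>

context finite_alphabet
begin

text \<open>The independence argument fixes a prefix and a suffix and lets only the middle of the
  word vary. It needs the same density \<open>d\<close> for every such choice.\<close>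

definition quotient_density :: "'a list set \<Rightarrow> real \<Rightarrow> bool" where
  "quotient_density K d \<longleftrightarrow> (\<forall>u\<in>lists A. \<forall>v\<in>lists A.
     cesaro (\<lambda>k. word_avg A k (\<lambda>z. of_bool (u @ z @ v \<in> K))) \<longlonglongrightarrow> d)"

text \<open>This instance lets the estimate for \<open>L \<inter> K\<close> also yield the density
  of \<open>L\<close> itself.\<close>

lemma quotient_density_lists: "quotient_density (lists A) 1"
proof -
  have "word_avg A k (\<lambda>z. of_bool (u @ z @ v \<in> lists A)) = 1" if "u \<in> lists A" "v \<in> lists A" for k u v
  proof -
    have "word_avg A k (\<lambda>z. of_bool (u @ z @ v \<in> lists A)) = word_avg A k (\<lambda>z. 1)"
      using that by (intro word_avg_cong) (simp add: nlists_in_lists)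
    then show ?thesis by simp
  qed
  moreover have "cesaro (\<lambda>k. 1) \<longlonglongrightarrow> 1"
    by (rule tendsto_eventually) (auto simp: cesaro_def intro: eventually_sequentiallyI[of 1])
  ultimately show ?thesis
    by (simp add: quotient_density_def)
qed

lemma quotient_density_tendsto:
  "quotient_density K d \<Longrightarrow> lang_density_avg A K \<longlonglongrightarrow> d"
  unfolding quotient_density_def lang_density_avg_eq_cesaro
  by (drule bspec[where x = "[]"], simp, drule bspec[where x = "[]"], simp_all)

end

text \<open>Fixing \<open>u\<close> and \<open>v\<close> merely translates the target set within the
  image subgroup: \<open>g z\<close> has to be one of the elements
  \<open>inv (g u) \<otimes> h \<otimes> inv (g v)\<close>, each with the same limiting
  frequency.\<close>

lemma (in group_word_morphism) quotient_density_group: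
  "quotient_density {w \<in> lists A. g w \<in> S} (card (S \<inter> reachable) / card reachable)"
  unfolding quotient_density_def
proof (intro ballI)
  fix u v assume u: "u \<in> lists A" and v: "v \<in> lists A"
  let ?K = "{w \<in> lists A. g w \<in> S}"
  let ?t = "\<lambda>h. inv (g u) \<otimes> h \<otimes> inv (g v)"
  have fin: "finite (S \<inter> reachable)"
    using finite_reachable by simp
  have "of_bool (u @ z @ v \<in> ?K) = (\<Sum>h\<in>S \<inter> reachable. of_bool (g z = ?t h) :: real)"
    if "z \<in> nlists k A" for z k
  proof -
    have z: "z \<in> lists A"
      using that by (rule nlists_in_lists)
    have "g z = ?t h \<longleftrightarrow> h = g (u @ z @ v)" if "h \<in> reachable" for h
    proof -
      note carr = g_closed[OF u] g_closed[OF v] g_closed[OF z] reachable_closed[OF that]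
      have "g z = inv (g u) \<otimes> h \<otimes> inv (g v) \<longleftrightarrow> inv (g u) \<otimes> h = g z \<otimes> g v"
        using carr by (intro inv_solve_right) simp_all
      also have "\<dots> \<longleftrightarrow> h = g u \<otimes> (g z \<otimes> g v)"
        using carr by (intro inv_solve_left') simp_all
      also have "g u \<otimes> (g z \<otimes> g v) = g (u @ z @ v)"
        using u v z by (simp add: g_append)
      finally show ?thesis .
    qed
    then have "(\<Sum>h\<in>S \<inter> reachable. of_bool (g z = ?t h)) =
        (\<Sum>h\<in>S \<inter> reachable. if h = g (u @ z @ v) then 1 else 0 :: real)"
      by (intro sum.cong) auto
    then show ?thesis
      using u v z fin by simp
  qed
  then have "word_avg A k (\<lambda>z. of_bool (u @ z @ v \<in> ?K))
      = (\<Sum>h\<in>S \<inter> reachable. word_avg A k (\<lambda>z. of_bool (g z = ?t h)))" for k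
    by (subst word_avg_sum[symmetric]) (rule word_avg_cong)
  then have "cesaro (\<lambda>k. word_avg A k (\<lambda>z. of_bool (u @ z @ v \<in> ?K)))
      = (\<lambda>n. \<Sum>h\<in>S \<inter> reachable. visits (?t h) n)"
    by (intro ext) (simp add: cesaro_sum)
  moreover have "visits (?t h) \<longlonglongrightarrow> 1 / card reachable" if "h \<in> reachable" for h
    by (rule visits_tendsto)
      (rule reachable_mult[OF reachable_mult[OF reachable_inv[OF imageI[OF u]] that]
          reachable_inv[OF imageI[OF v]]])
  then have "(\<lambda>n. \<Sum>h\<in>S \<inter> reachable. visits (?t h) n)
      \<longlonglongrightarrow> (\<Sum>h\<in>S \<inter> reachable. 1 / card reachable)"
    by (rule tendsto_sum) blast
  ultimately show "cesaro (\<lambda>k. word_avg A k (\<lambda>z. of_bool (u @ z @ v \<in> ?K)))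
      \<longlonglongrightarrow> card (S \<inter> reachable) / card reachable"
    by simp
qed

subsection \<open>Words in the minimal ideal\<close>

lemma sublist_extend: "sublist x u \<Longrightarrow> sublist x (p @ u @ q)"
  by (meson sublist_appendI sublist_order.order_trans)

lemma (in monoid) l_coset_eqI:
  assumes "x \<in> carrier G" "y \<in> carrier G" "c \<in> carrier G" "d \<in> carrier G"
    and "x = y \<otimes> c" "y = x \<otimes> d"
  shows "x <# carrier G = y <# carrier G"
proof -
  have "a <# carrier G \<subseteq> b <# carrier G"
    if "b \<in> carrier G" "c \<in> carrier G" "a = b \<otimes> c" for a b c
    using that by (auto simp: l_coset_def m_assoc)
  then show ?thesis
    using assms by (intro equalityI) blast+
qed

lemma (in monoid) r_coset_eqI:
  assumes "x \<in> carrier G" "y \<in> carrier G" "c \<in> carrier G" "d \<in> carrier G"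
    and "x = c \<otimes> y" "y = d \<otimes> x"
  shows "carrier G #> x = carrier G #> y"
proof -
  have "carrier G #> a \<subseteq> carrier G #> b"
    if "b \<in> carrier G" "c \<in> carrier G" "a = c \<otimes> b" for a b c
    using that by (auto simp: r_coset_def simp flip: m_assoc)
  then show ?thesis
    using assms by (intro equalityI) blast+
qed

context word_morphism
begin

lemma append_lists: "u \<in> lists A \<Longrightarrow> v \<in> lists A \<Longrightarrow> u @ v \<in> lists A"
  by simp

lemma finite_image_lists: "(\<And>v. v \<in> lists A \<Longrightarrow> f v \<in> lists A) \<Longrightarrow> finite ((\<lambda>v. g (f v)) ` lists A)"
  using g_closed by (intro finite_subset[OF _ finite_carrier]) blast

text \<open>Take \<open>w\<close> whose right ideal within the image of \<open>g\<close> has least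
  cardinality. Every word \<open>u\<close> containing \<open>w\<close> inherits this minimality, so
  extending \<open>u\<close> on the right cannot shrink its ideal, and \<open>g u\<close> can be
  recovered.\<close>

lemma minimal_right_ideal:
  obtains w where "w \<in> lists A"
    "\<And>u y. u \<in> lists A \<Longrightarrow> y \<in> lists A \<Longrightarrow> sublist w u \<Longrightarrow>
       \<exists>c\<in>carrier M. g u = g (u @ y) \<otimes> c"
proof -
  define R where "R w = (\<lambda>v. g (w @ v)) ` lists A" for w
  have fin: "finite (R w)" if "w \<in> lists A" for w
    unfolding R_def by (rule finite_image_lists) (rule append_lists[OF that])
  have sub: "R (w @ v) \<subseteq> R w" if "v \<in> lists A" for w v
    unfolding R_def using that by (force simp del: in_lists_conv_set intro: append_lists)
  have "\<exists>w. w \<in> lists A \<and> (\<forall>v. v \<in> lists A \<longrightarrow> card (R w) \<le> card (R v))"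
    using ex_has_least_nat[of "\<lambda>w. w \<in> lists A" "[]" "\<lambda>w. card (R w)"] by simp
  then obtain w where w: "w \<in> lists A" "\<And>v. v \<in> lists A \<Longrightarrow> card (R w) \<le> card (R v)"
    by blast
  show thesis
  proof (rule that[OF w(1)])
    fix u y assume u: "u \<in> lists A" and y: "y \<in> lists A" and "sublist w u"
    then obtain p q where pq: "u = p @ w @ q"
      by (auto simp: sublist_def)
    then have lists: "p \<in> lists A" "q \<in> lists A"
      using u by simp_all
    have wq: "R (w @ q) \<subseteq> R w"
      by (rule sub[OF lists(2)])
    \<comment> \<open>Left translation by \<open>g p\<close> cannot increase cardinality, so
      minimality survives wherever \<open>w\<close> occurs in \<open>u\<close>.\<close>
    have "R u = (\<lambda>x. g p \<otimes> x) ` R (w @ q)"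
      unfolding R_def image_image using lists w(1)
      by (intro image_cong refl) (simp add: pq g_append m_assoc)
    then have "card (R u) \<le> card (R (w @ q))"
      using fin[OF append_lists[OF w(1) lists(2)]] by (simp add: card_image_le)
    also have "\<dots> \<le> card (R w)"
      by (rule card_mono[OF fin[OF w(1)] wq])
    also have "\<dots> \<le> card (R (u @ y))"
      by (rule w(2)[OF append_lists[OF u y]])
    finally have "R (u @ y) = R u"
      by (rule card_seteq[OF fin[OF u] sub[OF y]])
    moreover have "g u \<in> R u"
      unfolding R_def by (rule image_eqI[where x = "[]"]) simp_all
    ultimately have "g u \<in> R (u @ y)"
      by simp
    then obtain v where v: "v \<in> lists A" "g u = g ((u @ y) @ v)"
      unfolding R_def by (rule imageE)
    have "g u = g (u @ y) \<otimes> g v"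
      unfolding v(2) by (rule g_append[OF append_lists[OF u y] v(1)])
    then show "\<exists>c\<in>carrier M. g u = g (u @ y) \<otimes> c"
      using g_closed[OF v(1)] by blast
  qed
qed

text \<open>The mirror image of \<open>minimal_right_ideal\<close>, with prefixes and left ideals in
  place of suffixes and right ideals.\<close>

lemma minimal_left_ideal:
  obtains w where "w \<in> lists A"
    "\<And>u y. u \<in> lists A \<Longrightarrow> y \<in> lists A \<Longrightarrow> sublist w u \<Longrightarrow>
       \<exists>c\<in>carrier M. g u = c \<otimes> g (y @ u)"
proof -
  define R where "R w = (\<lambda>v. g (v @ w)) ` lists A" for w
  have fin: "finite (R w)" if "w \<in> lists A" for w
    unfolding R_def by (rule finite_image_lists) (rule append_lists[OF _ that])
  have sub: "R (v @ w) \<subseteq> R w" if "v \<in> lists A" for w v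
    unfolding R_def using that
    by (force simp del: in_lists_conv_set append_assoc simp flip: append_assoc intro: append_lists)
  have "\<exists>w. w \<in> lists A \<and> (\<forall>v. v \<in> lists A \<longrightarrow> card (R w) \<le> card (R v))"
    using ex_has_least_nat[of "\<lambda>w. w \<in> lists A" "[]" "\<lambda>w. card (R w)"] by simp
  then obtain w where w: "w \<in> lists A" "\<And>v. v \<in> lists A \<Longrightarrow> card (R w) \<le> card (R v)"
    by blast
  show thesis
  proof (rule that[OF w(1)])
    fix u y assume u: "u \<in> lists A" and y: "y \<in> lists A" and "sublist w u"
    then obtain p q where pq: "u = p @ w @ q"
      by (auto simp: sublist_def)
    then have lists: "p \<in> lists A" "q \<in> lists A"
      using u by simp_all
    have pw: "R (p @ w) \<subseteq> R w"
      by (rule sub[OF lists(1)])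
    have "R u = (\<lambda>x. x \<otimes> g q) ` R (p @ w)"
      unfolding R_def image_image using lists w(1)
      by (intro image_cong refl) (simp add: pq g_append m_assoc)
    then have "card (R u) \<le> card (R (p @ w))"
      using fin[OF append_lists[OF lists(1) w(1)]] by (simp add: card_image_le)
    also have "\<dots> \<le> card (R w)"
      by (rule card_mono[OF fin[OF w(1)] pw])
    also have "\<dots> \<le> card (R (y @ u))"
      by (rule w(2)[OF append_lists[OF y u]])
    finally have "R (y @ u) = R u"
      by (rule card_seteq[OF fin[OF u] sub[OF y]])
    moreover have "g u \<in> R u"
      unfolding R_def by (rule image_eqI[where x = "[]"]) simp_all
    ultimately have "g u \<in> R (y @ u)"
      by simp
    then obtain v where v: "v \<in> lists A" "g u = g (v @ y @ u)"
      unfolding R_def by (rule imageE)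
    have "g u = g v \<otimes> g (y @ u)"
      unfolding v(2) by (rule g_append[OF v(1) append_lists[OF y u]])
    then show "\<exists>c\<in>carrier M. g u = c \<otimes> g (y @ u)"
      using g_closed[OF v(1)] by blast
  qed
qed

text \<open>Products \<open>x y z\<close> and \<open>x z\<close> with \<open>x\<close>, \<open>z\<close> in the minimal ideal both generate the right ideal
  of \<open>x\<close> and the left ideal of \<open>z\<close>. In an \<open>\<H>\<close>-trivial monoid they therefore agree.\<close>

lemma synchronising_word:
  assumes "H_trivial M"
  obtains w where "w \<in> lists A"
    "\<And>u z v. u \<in> lists A \<Longrightarrow> z \<in> lists A \<Longrightarrow> v \<in> lists A \<Longrightarrow> sublist w u \<Longrightarrow> sublist w v \<Longrightarrow>
       g (u @ z @ v) = g (u @ v)"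
proof -
  obtain r where r: "r \<in> lists A"
    "\<And>u y. u \<in> lists A \<Longrightarrow> y \<in> lists A \<Longrightarrow> sublist r u \<Longrightarrow>
       \<exists>c\<in>carrier M. g u = g (u @ y) \<otimes> c"
    using minimal_right_ideal by metis
  obtain l where l: "l \<in> lists A"
    "\<And>u y. u \<in> lists A \<Longrightarrow> y \<in> lists A \<Longrightarrow> sublist l u \<Longrightarrow>
       \<exists>c\<in>carrier M. g u = c \<otimes> g (y @ u)"
    using minimal_left_ideal by metis
  show thesis
  \<comment> \<open>A word containing \<open>r @ l\<close> contains both \<open>r\<close> and
    \<open>l\<close>, so one word serves for both ideals.\<close>
  proof (rule that[OF append_lists[OF r(1) l(1)]])
    fix u z v
    assume lists: "u \<in> lists A" "z \<in> lists A" "v \<in> lists A"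
      and sub: "sublist (r @ l) u" "sublist (r @ l) v"
    have ru: "sublist r u" and lv: "sublist l v"
      using sub sublist_order.order_trans[OF sublist_append_rightI sub(1)]
        sublist_order.order_trans[OF sublist_append_leftI sub(2)] by simp_all
    let ?x = "g (u @ z @ v)" and ?y = "g (u @ v)"
    have carr: "?x \<in> carrier M" "?y \<in> carrier M" "g u \<in> carrier M" "g v \<in> carrier M"
      "g (z @ v) \<in> carrier M" "g (u @ z) \<in> carrier M"
      using lists by simp_all
    have x: "?x = g u \<otimes> g (z @ v)" "?x = g (u @ z) \<otimes> g v" and y: "?y = g u \<otimes> g v"
      using lists by (simp_all add: g_append m_assoc)
    \<comment> \<open>Both \<open>?x\<close> and \<open>?y\<close> return to \<open>g u\<close> by
      right multiplication and to \<open>g v\<close> by left multiplication. From there each reaches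
      the other, which yields the four factors used below.\<close>
    obtain c where c: "c \<in> carrier M" "g u = ?x \<otimes> c"
      using r(2)[OF lists(1) append_lists[OF lists(2,3)] ru] by blast
    obtain d where d: "d \<in> carrier M" "g u = ?y \<otimes> d"
      using r(2)[OF lists(1) lists(3) ru] by blast
    obtain c' where c': "c' \<in> carrier M" "g v = c' \<otimes> ?x"
      using l(2)[OF lists(3) append_lists[OF lists(1,2)] lv] by (auto simp: append_assoc)
    obtain d' where d': "d' \<in> carrier M" "g v = d' \<otimes> ?y"
      using l(2)[OF lists(3) lists(1) lv] by blast
    have "?x <# carrier M = ?y <# carrier M"
    proof (rule l_coset_eqI[OF carr(1,2)])
      show "?x = ?y \<otimes> (d \<otimes> g (z @ v))"
        using x(1) d carr m_assoc[OF carr(2) d(1) carr(5)] by simp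
      show "?y = ?x \<otimes> (c \<otimes> g v)"
        using y c carr m_assoc[OF carr(1) c(1) carr(4)] by simp
    qed (use c d carr in simp_all)
    moreover have "carrier M #> ?x = carrier M #> ?y"
    proof (rule r_coset_eqI[OF carr(1,2)])
      show "?x = (g (u @ z) \<otimes> d') \<otimes> ?y"
        using x(2) d' carr m_assoc[OF carr(6) d'(1) carr(2)] by simp
      show "?y = (g u \<otimes> c') \<otimes> ?x"
        using y c' carr m_assoc[OF carr(3) c'(1) carr(1)] by simp
    qed (use c' d' carr in simp_all)
    ultimately have "(?x, ?y) \<in> green_H M"
      using carr by (simp add: green_H_def)
    then show "?x = ?y"
      using assms by (simp add: H_trivial_iff)
  qed
qed

end

subsection \<open>Asymptotic independence\<close>

context finite_alphabet
begin

definition avoid :: "'a list \<Rightarrow> nat \<Rightarrow> real" where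
  "avoid x k = word_avg A k (\<lambda>w. of_bool (\<not> sublist x w))"

lemma avoid_nonneg: "0 \<le> avoid x k"
  by (simp add: avoid_def word_avg_nonneg)

text \<open>If a word avoids \<open>x\<close>, so do its prefix of length \<open>j\<close> and its
  suffix of length \<open>k\<close>, and these are independent under the uniform
  distribution.\<close>

lemma avoid_add_le: "avoid x (j + k) \<le> avoid x j * avoid x k"
proof -
  have "avoid x (j + k) \<le> word_avg A j (\<lambda>u. word_avg A k
      (\<lambda>v. of_bool (\<not> sublist x u) * of_bool (\<not> sublist x v)))"
    unfolding avoid_def word_avg_append
    using sublist_extend[of x _ "[]"] sublist_extend[of x _ _ "[]"]
    by (intro word_avg_mono) auto
  then show ?thesis
    by (simp add: avoid_def word_avg_cmult word_avg_multc)
qed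

text \<open>\<open>x\<close> is itself one of the words of this length and does not avoid
  \<open>x\<close>.\<close>

lemma avoid_length_less_1:
  assumes "x \<in> lists A"
  shows "avoid x (length x) < 1"
proof -
  let ?k = "length x"
  have x: "x \<in> nlists ?k A"
    using assms by (intro nlistsI) auto
  have "(\<Sum>w\<in>nlists ?k A. of_bool (\<not> sublist x w)) < (\<Sum>w\<in>nlists ?k A. 1 :: real)"
    by (intro sum_strict_mono_ex1 finite_nlists ballI bexI[OF _ x]) simp_all
  then show ?thesis
    using card_nlists_pos[of ?k] by (simp add: avoid_def word_avg_def)
qed

text \<open>Cutting a word into blocks of length \<open>length x\<close> gives geometric decay by
  \<open>avoid_add_le\<close>.\<close>

lemma ex_avoid_less:
  assumes "x \<in> lists A" "e > 0"
  obtains k where "avoid x k < e"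
proof -
  have "avoid x (n * length x) \<le> avoid x (length x) ^ n" for n
  proof (induction n)
    case 0
    show ?case
      by (simp add: avoid_def word_avg_le_1)
  next
    case (Suc n)
    have "avoid x (Suc n * length x) \<le> avoid x (length x) * avoid x (n * length x)"
      using avoid_add_le[of x "length x" "n * length x"] by simp
    also have "\<dots> \<le> avoid x (length x) * avoid x (length x) ^ n"
      by (intro mult_left_mono Suc.IH avoid_nonneg)
    finally show ?case
      by simp
  qed
  moreover obtain n where "avoid x (length x) ^ n < e"
    using real_arch_pow_inv[OF assms(2) avoid_length_less_1[OF assms(1)]] by blast
  ultimately show thesis
    using that order_le_less_trans by blast
qed

text \<open>Write a long word as \<open>u @ z @ v\<close> with \<open>u\<close> and \<open>v\<close>
  of length \<open>s\<close>. Unless \<open>u\<close> or \<open>v\<close> avoids \<open>x\<close>,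
  membership in \<open>L\<close> depends on \<open>u @ v\<close> alone, and averaging over
  \<open>z\<close> contributes the factor \<open>d\<close>.\<close>

lemma lang_density_avg_approx:
  assumes K: "quotient_density K d"
    and sync: "\<And>u z v. u \<in> lists A \<Longrightarrow> z \<in> lists A \<Longrightarrow> v \<in> lists A \<Longrightarrow>
      sublist x u \<Longrightarrow> sublist x v \<Longrightarrow> u @ z @ v \<in> L \<longleftrightarrow> u @ v \<in> L"
    and e: "e > 0"
  shows "\<forall>\<^sub>F n in sequentially. \<bar>lang_density_avg A (L \<inter> K) n
      - word_avg A (s + s) (\<lambda>w. of_bool (w \<in> L)) * d\<bar> < 2 * avoid x s + e"
proof -
  let ?p = "\<lambda>k. word_avg A k (\<lambda>w. of_bool (w \<in> L \<inter> K))"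
  let ?q = "\<lambda>u v k. word_avg A k (\<lambda>z. of_bool (u @ z @ v \<in> K))"
  let ?l = "word_avg A (s + s) (\<lambda>w. of_bool (w \<in> L))"
  \<comment> \<open>The idealised frequency for length \<open>k + 2 s\<close>, in which membership
    of \<open>u @ z @ v\<close> in \<open>L\<close> is replaced by that of
    \<open>u @ v\<close>.\<close>
  define a where "a k = word_avg A s (\<lambda>u. word_avg A s (\<lambda>v. of_bool (u @ v \<in> L) * ?q u v k))" for k
  have close: "\<bar>?p (k + (s + s)) - a k\<bar> \<le> 2 * avoid x s" for k
  proof -
    let ?f = "\<lambda>u z v. of_bool (u @ z @ v \<in> L \<inter> K) - of_bool (u @ v \<in> L) * of_bool (u @ z @ v \<in> K) :: real"
    have p: "?p (k + (s + s)) = word_avg A s (\<lambda>u. word_avg A k (\<lambda>z. word_avg A s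
        (\<lambda>v. of_bool (u @ z @ v \<in> L \<inter> K))))"
      unfolding add.left_commute[of k s s] word_avg_append ..
    have a: "a k = word_avg A s (\<lambda>u. word_avg A k (\<lambda>z. word_avg A s
        (\<lambda>v. of_bool (u @ v \<in> L) * of_bool (u @ z @ v \<in> K))))"
      unfolding a_def word_avg_cmult[symmetric] by (subst (2) word_avg_swap) (rule refl)
    have "?p (k + (s + s)) - a k = word_avg A s (\<lambda>u. word_avg A k (\<lambda>z. word_avg A s (?f u z)))"
      unfolding p a word_avg_diff ..
    also have "\<bar>\<dots>\<bar> \<le> word_avg A s (\<lambda>u. word_avg A k (\<lambda>z. word_avg A s (\<lambda>v. \<bar>?f u z v\<bar>)))"
      by (intro order_trans[OF word_avg_abs_le] word_avg_mono order_refl)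
    also have "\<dots> \<le> word_avg A s (\<lambda>u. word_avg A k (\<lambda>z. word_avg A s
        (\<lambda>v. of_bool (\<not> sublist x u) + of_bool (\<not> sublist x v))))"
    proof (intro word_avg_mono)
      fix u z v assume "u \<in> nlists s A" "z \<in> nlists k A" "v \<in> nlists s A"
      from this[THEN nlists_in_lists] show
        "\<bar>?f u z v\<bar> \<le> of_bool (\<not> sublist x u) + of_bool (\<not> sublist x v)"
        \<comment> \<open>If both ends contain \<open>x\<close> the difference is 0; otherwise it is
          at most 1 in absolute value, and so is covered by the right-hand side.\<close>
        using sync[of u z v] by (cases "sublist x u"; cases "sublist x v") auto
    qed
    also have "\<dots> = 2 * avoid x s"
      by (simp add: word_avg_add avoid_def)
    finally show ?thesis .
  qed
  have "cesaro a = (\<lambda>n. word_avg A s (\<lambda>u. word_avg A s (\<lambda>v. of_bool (u @ v \<in> L) * cesaro (?q u v) n)))"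
    unfolding a_def cesaro_word_avg cesaro_cmult ..
  also have "\<dots> \<longlonglongrightarrow> word_avg A s (\<lambda>u. word_avg A s (\<lambda>v. of_bool (u @ v \<in> L) * d))"
  proof (intro tendsto_word_avg tendsto_mult tendsto_const)
    fix u v assume "u \<in> nlists s A" "v \<in> nlists s A"
    then show "cesaro (?q u v) \<longlonglongrightarrow> d"
      using K nlists_in_lists unfolding quotient_density_def by blast
  qed
  also have "word_avg A s (\<lambda>u. word_avg A s (\<lambda>v. of_bool (u @ v \<in> L) * d)) = ?l * d"
    by (simp add: word_avg_append word_avg_multc)
  finally have a_lim: "cesaro a \<longlonglongrightarrow> ?l * d" .
  \<comment> \<open>\<open>a\<close> is reindexed by the full word length. Below \<open>2 s\<close>
    no such splitting exists, so \<open>b\<close> copies the true values there: the error bound then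
    holds for all \<open>k\<close>, and the limit is unaffected.\<close>
  define b where "b k = (if k < s + s then ?p k else a (k - (s + s)))" for k
  have "cesaro b \<longlonglongrightarrow> ?l * d"
    by (rule cesaro_tendsto_offset[where l = "s + s"]) (simp add: b_def a_lim)
  then have "\<forall>\<^sub>F n in sequentially. \<bar>cesaro b n - ?l * d\<bar> < e"
    using e by (simp add: tendsto_iff dist_real_def)
  moreover have "\<bar>lang_density_avg A (L \<inter> K) n - cesaro b n\<bar> \<le> 2 * avoid x s" for n
    unfolding lang_density_avg_eq_cesaro
  proof (rule cesaro_diff_le)
    fix k
    show "\<bar>?p k - b k\<bar> \<le> 2 * avoid x s"
    proof (cases "k < s + s")
      case True
      then show ?thesis
        by (simp add: b_def avoid_nonneg)
    next
      case False
      then have "k - (s + s) + (s + s) = k"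
        by simp
      with close[of "k - (s + s)"] False show ?thesis
        unfolding b_def by (simp only: if_False)
    qed
  qed
  ultimately show ?thesis
  proof (elim eventually_mono)
    fix n
    assume "\<bar>cesaro b n - ?l * d\<bar> < e"
      and "\<And>n. \<bar>lang_density_avg A (L \<inter> K) n - cesaro b n\<bar> \<le> 2 * avoid x s"
    from this(1) this(2)[of n]
    show "\<bar>lang_density_avg A (L \<inter> K) n - ?l * d\<bar> < 2 * avoid x s + e"
      by linarith
  qed
qed

end

section \<open>Passage to the limit\<close>

text \<open>The approximating value may change with \<open>e\<close>, but it is shared by
  \<open>f\<close> and \<open>h\<close>. It makes \<open>f\<close> Cauchy and lies close to the
  limit of \<open>f\<close>, which then determines the limit of \<open>h\<close>.\<close>

lemma common_approx_tendsto:
  fixes f h :: "nat \<Rightarrow> real"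
  assumes "\<And>e. e > 0 \<Longrightarrow> \<exists>l. (\<forall>\<^sub>F n in sequentially. \<bar>f n - l\<bar> < e) \<and>
      (\<forall>\<^sub>F n in sequentially. \<bar>h n - l * d\<bar> < e)"
  obtains l where "f \<longlonglongrightarrow> l" "h \<longlonglongrightarrow> l * d"
proof -
  have "Cauchy f"
    unfolding Cauchy_def
  proof (intro allI impI)
    fix e :: real assume "e > 0"
    then obtain l where "\<forall>\<^sub>F n in sequentially. \<bar>f n - l\<bar> < e / 2"
      using assms[of "e / 2"] by auto
    then obtain N where N: "\<And>n. n \<ge> N \<Longrightarrow> \<bar>f n - l\<bar> < e / 2"
      by (auto simp: eventually_sequentially)
    have "dist (f m) (f n) < e" if "m \<ge> N" "n \<ge> N" for m n
      using N[OF that(1)] N[OF that(2)] unfolding dist_real_def by linarith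
    then show "\<exists>N. \<forall>m\<ge>N. \<forall>n\<ge>N. dist (f m) (f n) < e"
      by blast
  qed
  then obtain l where l: "f \<longlonglongrightarrow> l"
    using Cauchy_convergent convergent_def by blast
  have "h \<longlonglongrightarrow> l * d"
    unfolding tendsto_iff
  proof (intro allI impI)
    fix e :: real assume "e > 0"
    \<comment> \<open>The total error is below \<open>c\<close> plus \<open>2 * c\<close> times the
      absolute value of \<open>d\<close>, hence below \<open>e\<close>.\<close>
    define c where "c = e / (2 + 2 * \<bar>d\<bar>)"
    have c: "c > 0" "c * (2 + 2 * \<bar>d\<bar>) = e"
      using \<open>e > 0\<close> unfolding c_def by (simp_all add: add_pos_nonneg)
    obtain m where m: "\<forall>\<^sub>F n in sequentially. \<bar>f n - m\<bar> < c"
      "\<forall>\<^sub>F n in sequentially. \<bar>h n - m * d\<bar> < c"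
      using assms[OF c(1)] by blast
    have "\<forall>\<^sub>F n in sequentially. \<bar>f n - l\<bar> < c"
      using l c(1) by (simp add: tendsto_iff dist_real_def)
    with m show "\<forall>\<^sub>F n in sequentially. dist (h n) (l * d) < e"
    proof eventually_elim
      case (elim n)
      \<comment> \<open>Both \<open>m\<close> and \<open>l\<close> are within \<open>c\<close> of
        the same value \<open>f n\<close>.\<close>
      then have "\<bar>m - l\<bar> \<le> 2 * c"
        by linarith
      then have "\<bar>m - l\<bar> * \<bar>d\<bar> \<le> (2 * c) * \<bar>d\<bar>"
        by (rule mult_right_mono) simp
      moreover have "\<bar>m - l\<bar> * \<bar>d\<bar> = \<bar>m * d - l * d\<bar>"
        by (simp add: left_diff_distrib flip: abs_mult)
      moreover have "c * (2 + 2 * \<bar>d\<bar>) = 2 * c + (2 * c) * \<bar>d\<bar>"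
        by (simp add: distrib_left)
      ultimately show ?case
        using elim c unfolding dist_real_def by linarith
    qed
  qed
  with l show thesis
    using that by blast
qed

lemma recognises_word_morphism:
  assumes "finite A" "A \<noteq> {}" "monoid M" "finite (carrier M)" "recognises M A L"
  obtains g S where "word_morphism A M g" "L = {w \<in> lists A. g w \<in> S}"
proof -
  obtain \<eta> S where \<eta>: "\<eta> \<in> hom (free_monoid A) M" "\<eta> [] = \<one>\<^bsub>M\<^esub>" "L = {w \<in> lists A. \<eta> w \<in> S}"
    using assms(5) unfolding recognises_def by (auto simp: free_monoid_def)
  have "\<eta> w \<in> carrier M" if "w \<in> lists A" for w
    using hom_in_carrier[OF \<eta>(1)] that by (simp add: free_monoid_def)
  moreover have "\<eta> (u @ v) = \<eta> u \<otimes>\<^bsub>M\<^esub> \<eta> v" if "u \<in> lists A" "v \<in> lists A" for u v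
    using hom_mult[OF \<eta>(1)] that by (simp add: free_monoid_def)
  ultimately have "word_morphism A M \<eta>"
    using assms \<eta>(2)
    by (intro word_morphism.intro finite_alphabet.intro word_morphism_axioms.intro)
  then show thesis
    using \<eta>(3) that by blast
qed

theorem theorem18:
  fixes A :: "'a set" and L K :: "'a list set"
  assumes "finite A" and "card A \<ge> 2"
    and "star_free_language A L" and "group_language A K"
  shows "has_density A L \<and> has_density A K \<and> has_density A (L \<inter> K) \<and>
    lang_density A (L \<inter> K) = lang_density A L * lang_density A K"
proof -
  have nonempty: "A \<noteq> {}"
    using assms(2) by auto
  interpret finite_alphabet A
    using assms(1) nonempty by unfold_locales
  obtain M :: "nat monoid" where M: "monoid M" "finite (carrier M)" "H_trivial M" "recognises M A L"
    using assms(3) unfolding star_free_language_def by blast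
  obtain G :: "nat monoid" where G: "group G" "finite (carrier G)" "recognises G A K"
    using assms(4) unfolding group_language_def by blast
  obtain g S where g: "word_morphism A M g" "L = {w \<in> lists A. g w \<in> S}"
    using recognises_word_morphism[OF assms(1) nonempty M(1,2,4)] by blast
  obtain h T where h: "word_morphism A G h" "K = {w \<in> lists A. h w \<in> T}"
    using recognises_word_morphism[OF assms(1) nonempty group.is_monoid[OF G(1)] G(2,3)] by blast
  interpret h: group_word_morphism A G h
    using h(1) G(1) by (rule group_word_morphism.intro)
  obtain d where d: "quotient_density K d"
    using h.quotient_density_group[of T] h(2) by metis
  obtain x where x: "x \<in> lists A"
    "\<And>u z v. u \<in> lists A \<Longrightarrow> z \<in> lists A \<Longrightarrow> v \<in> lists A \<Longrightarrow> sublist x u \<Longrightarrow> sublist x v \<Longrightarrow>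
       g (u @ z @ v) = g (u @ v)"
    using word_morphism.synchronising_word[OF g(1) M(3)] by blast
  have sync: "u @ z @ v \<in> L \<longleftrightarrow> u @ v \<in> L"
    if "u \<in> lists A" "z \<in> lists A" "v \<in> lists A" "sublist x u" "sublist x v" for u z v
    unfolding g(2) using that x(2)[OF that] by simp
  have "\<exists>l. (\<forall>\<^sub>F n in sequentially. \<bar>lang_density_avg A L n - l\<bar> < e) \<and>
      (\<forall>\<^sub>F n in sequentially. \<bar>lang_density_avg A (L \<inter> K) n - l * d\<bar> < e)" if e: "e > 0" for e
  proof -
    \<comment> \<open>One \<open>s\<close> gives one approximating value for both languages, with
      error \<open>2 * avoid x s + e / 2 < e\<close>. For \<open>L\<close> alone the estimate is
      applied with \<open>lists A\<close> as the second language and density 1.\<close>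
    obtain s where s: "avoid x s < e / 4"
      by (rule ex_avoid_less[OF x(1), of "e / 4"]) (use e in simp_all)
    have "L \<inter> lists A = L"
      using g(2) by blast
    then have "\<forall>\<^sub>F n in sequentially. \<bar>lang_density_avg A L n
        - word_avg A (s + s) (\<lambda>w. of_bool (w \<in> L)) * 1\<bar> < 2 * avoid x s + e / 2"
      using lang_density_avg_approx[OF quotient_density_lists sync, where e = "e / 2" and s = s] e by simp
    moreover have "\<forall>\<^sub>F n in sequentially. \<bar>lang_density_avg A (L \<inter> K) n
        - word_avg A (s + s) (\<lambda>w. of_bool (w \<in> L)) * d\<bar> < 2 * avoid x s + e / 2"
      using lang_density_avg_approx[OF d sync, where e = "e / 2" and s = s] e by simp
    moreover have "2 * avoid x s + e / 2 < e"
      using s by simp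
    ultimately show ?thesis
      by (intro exI[of _ "word_avg A (s + s) (\<lambda>w. of_bool (w \<in> L))"] conjI)
        (erule eventually_mono, simp)+
  qed
  then obtain l where "lang_density_avg A L \<longlonglongrightarrow> l" "lang_density_avg A (L \<inter> K) \<longlonglongrightarrow> l * d"
    by (rule common_approx_tendsto)
  then show ?thesis
    using quotient_density_tendsto[OF d]
    by (auto simp: has_density_def lang_density_def convergent_def limI)
qed

end
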